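(* Let $\beta$ be a Salem number of degree six with minimal polynomial $P(x)$. Then $\beta \in P_{1,7} \cap C_{x^2-x+1}$ (that is, $d_\beta(1)$ is eventually periodic with preperiod length $1$ and period length $7$, and the co-factor of $\beta$ is $x^2-x+1$) if and only if $P(x)$ is one of the following three polynomials: $$x^6 - x^4 - x^3 - x^2 + 1,\qquad x^6 - x^4 - 2x^3 - x^2 + 1,\qquad x^6 - 2x^4 - 3x^3 - 2x^2 + 1.$$
   Context: A Salem number is a real algebraic integer $\beta>1$ whose other Galois conjugates all satisfy $|\alpha|\le 1$, with at least one satisfying $|\alpha|=1$. For real $\beta>1$, the greedy beta expansion $d_\beta(1)=(c_n)_{n\ge1}$ is defined by $r_0=1$, and for $n\ge 1$: $c_n=\lfloor \beta r_{n-1}\rfloor$, $r_n=\beta r_{n-1}-\lfloor \beta r_{n-1}\rfloor$. If it is eventually periodic, $\beta$ is called a Parry number, and the smallest $m\ge0$ and $p\ge1$ with $c_{n+m}=c_{n+m+p}$ for all $n\ge1$ are the preperiod length and the period length of the expansion. (By convention $p=0$ if $r_N=0$ for some $N$; this never happens for Salem numbers.) For a Salem number $\beta$ that is a Parry number with preperiod length $m$ and period length $p\geq 1$, put $P_k(x)=x^k-c_1x^{k-1}-\dots-c_k$. The companion polynomial is $R(x)=P_{m+p}(x)-P_m(x)$; it has $\beta$ as a root, so $R(x)=P(x)Q(x)$ with $P$ the minimal polynomial of $\beta$ and $Q\in\mathbb{Z}[x]$; $Q$ is the co-factor of $\beta$. $P_{m,p}$ denotes the set of Salem Parry numbers whose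 beta expansion $d_\beta(1)$ has preperiod length $m$ and period length $p$. $C_{Q(x)}$ denotes the set of all Salem (Parry) numbers whose co-factor is $Q(x)$. *)

theory Defs
  imports Complex_Main "HOL-Computational_Algebra.Computational_Algebra"
begin

text \<open>The minimal polynomial over the rationals: the monic polynomial of least degree
  among the nonzero rational polynomials vanishing at \<open>x\<close>.\<close>

definition is_min_poly :: "rat poly \<Rightarrow> real \<Rightarrow> bool" where
  "is_min_poly P x \<longleftrightarrow>
     lead_coeff P = 1 \<and> poly (map_poly of_rat P) x = 0 \<and>
     (\<forall>q. q \<noteq> 0 \<and> poly (map_poly of_rat q) x = 0 \<longrightarrow> degree P \<le> degree q)"

definition galois_conjugates :: "real \<Rightarrow> complex set" where
  "galois_conjugates x = {z. \<exists>P. is_min_poly P x \<and> poly (map_poly of_rat P) z = 0}"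

definition salem :: "real \<Rightarrow> bool" where
  "salem \<beta> \<longleftrightarrow>
     \<beta> > 1 \<and> algebraic_int \<beta> \<and>
     (\<forall>z \<in> galois_conjugates \<beta> - {complex_of_real \<beta>}. cmod z \<le> 1) \<and>
     (\<exists>z \<in> galois_conjugates \<beta> - {complex_of_real \<beta>}. cmod z = 1)"

fun beta_rem :: "real \<Rightarrow> nat \<Rightarrow> real" where
  "beta_rem \<beta> 0 = 1"
| "beta_rem \<beta> (Suc n) = \<beta> * beta_rem \<beta> n - of_int \<lfloor>\<beta> * beta_rem \<beta> n\<rfloor>"

text \<open>Digits are indexed from 1; the value at 0 is meaningless and never used below.\<close>

definition beta_digit :: "real \<Rightarrow> nat \<Rightarrow> int" where
  "beta_digit \<beta> n = \<lfloor>\<beta> * beta_rem \<beta> (n - 1)\<rfloor>"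

definition beta_periodic :: "real \<Rightarrow> nat \<Rightarrow> nat \<Rightarrow> bool" where
  "beta_periodic \<beta> m p \<longleftrightarrow>
     p \<ge> 1 \<and> (\<forall>n\<ge>1. beta_digit \<beta> (n + m) = beta_digit \<beta> (n + m + p))"

definition parry :: "real \<Rightarrow> bool" where
  "parry \<beta> \<longleftrightarrow> \<beta> > 1 \<and> (\<exists>m p. beta_periodic \<beta> m p)"

definition preperiod_length :: "real \<Rightarrow> nat" where
  "preperiod_length \<beta> = (LEAST m. \<exists>p. beta_periodic \<beta> m p)"

text \<open>Any two admissible pairs have an admissible componentwise minimum, so it is harmless
  to minimise first the preperiod and then the period. Finite expansions have period 0
  by convention.\<close>

definition period_length :: "real \<Rightarrow> nat" where
  "period_length \<beta> =
     (if \<exists>N. beta_rem \<beta> N = 0 then 0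
      else (LEAST p. beta_periodic \<beta> (preperiod_length \<beta>) p))"

definition beta_poly :: "real \<Rightarrow> nat \<Rightarrow> int poly" where
  "beta_poly \<beta> k = monom 1 k - (\<Sum>i=1..k. monom (beta_digit \<beta> i) (k - i))"

definition companion_poly :: "real \<Rightarrow> int poly" where
  "companion_poly \<beta> =
     beta_poly \<beta> (preperiod_length \<beta> + period_length \<beta>) - beta_poly \<beta> (preperiod_length \<beta>)"

definition is_cofactor :: "int poly \<Rightarrow> real \<Rightarrow> bool" where
  "is_cofactor Q \<beta> \<longleftrightarrow>
     (\<exists>P. is_min_poly P \<beta> \<and>
          map_poly of_int (companion_poly \<beta>) = P * map_poly of_int Q)"

definition salem_parry_numbers :: "nat \<Rightarrow> nat \<Rightarrow> real set" where
  "salem_parry_numbers m p =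
     {\<beta>. salem \<beta> \<and> parry \<beta> \<and> preperiod_length \<beta> = m \<and> period_length \<beta> = p}"

definition salem_with_cofactor :: "int poly \<Rightarrow> real set" where
  "salem_with_cofactor Q =
     {\<beta>. salem \<beta> \<and> parry \<beta> \<and> period_length \<beta> \<ge> 1 \<and> is_cofactor Q \<beta>}"

end

theory Submission
  imports Defs
begin

text \<open>
  A conjugate \<open>z\<close> on the unit circle satisfies \<open>1 / z = cnj z\<close>, so \<open>P\<close> is reciprocal up to sign.
  Comparing the coefficients of \<open>P \<cdot> (x\<^sup>2 - x + 1)\<close> with those of the companion polynomial then
  expresses all digits through three integers. The bounds \<open>0 \<le> c\<^sub>i \<le> c\<^sub>1\<close> and the rule
  \<open>c\<^sub>j = c\<^sub>1 \<Longrightarrow> c\<^sub>j\<^sub>+\<^sub>1 \<le> c\<^sub>2\<close> leave exactly three possibilities. Conversely, each of the three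
  polynomials locates \<open>\<beta>\<close> in a short interval, in which the remainders \<open>r\<^sub>1, \<dots>, r\<^sub>7\<close>, being integer
  polynomials in \<open>\<beta>\<close>, are seen to lie strictly between 0 and 1, while \<open>r\<^sub>8 = r\<^sub>1\<close> amounts to
  \<open>R \<beta> = 0\<close>; since 7 is prime and the periodic block is not constant, 7 is the exact period.
\<close>

section \<open>Minimal polynomials\<close>

lemma poly_of_rat_add:
  "poly (map_poly of_rat (p + q)) (x :: 'a :: field_char_0) =
     poly (map_poly of_rat p) x + poly (map_poly of_rat q) x"
proof -
  have "map_poly of_rat (p + q) = map_poly of_rat p + (map_poly of_rat q :: 'a poly)"
    by (intro poly_eqI) (simp add: coeff_map_poly of_rat_add)
  then show ?thesis by simp
qed

lemma poly_of_rat_smult: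
  "poly (map_poly of_rat (smult c p)) (x :: 'a :: field_char_0) =
     of_rat c * poly (map_poly of_rat p) x"
proof -
  have "map_poly of_rat (smult c p) = smult (of_rat c) (map_poly of_rat p :: 'a poly)"
    by (intro poly_eqI) (simp add: coeff_map_poly of_rat_mult)
  then show ?thesis by simp
qed

lemma poly_of_rat_pCons:
  "poly (map_poly of_rat (pCons c p)) (x :: 'a :: field_char_0) =
     of_rat c + x * poly (map_poly of_rat p) x"
  by (simp add: map_poly_pCons)

lemma poly_of_rat_mult:
  "poly (map_poly of_rat (p * q)) (x :: 'a :: field_char_0) =
     poly (map_poly of_rat p) x * poly (map_poly of_rat q) x"
proof (induction p)
  case (pCons c p)
  then show ?case
    by (simp add: poly_of_rat_add poly_of_rat_smult poly_of_rat_pCons algebra_simps)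
qed simp

lemma poly_of_rat_mod:
  assumes "poly (map_poly of_rat p) (x :: 'a :: field_char_0) = 0"
    and "poly (map_poly of_rat q) x = 0"
  shows "poly (map_poly of_rat (p mod q)) x = 0"
proof -
  have "poly (map_poly of_rat (p div q * q + p mod q)) x = 0"
    using assms(1) by simp
  then show ?thesis
    using assms(2) by (simp only: poly_of_rat_add poly_of_rat_mult) simp
qed

text \<open>Both polynomials are monic of the same least degree, so their difference has smaller
  degree and still vanishes at \<open>x\<close>. Uniqueness lets the existential quantifiers in
  \<open>galois_conjugates\<close> and \<open>is_cofactor\<close> be read with the given
  \<open>P\<close>.\<close>

lemma is_min_poly_unique:
  assumes "is_min_poly P x" and "is_min_poly P' x"
  shows "P = P'"
proof (rule ccontr)
  assume "P \<noteq> P'"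
  define q where "q = P + smult (- 1) P'"
  have q0: "q \<noteq> 0" using \<open>P \<noteq> P'\<close> by (simp add: q_def)
  have nz: "P \<noteq> 0" "P' \<noteq> 0" using assms by (auto simp: is_min_poly_def)
  have deg: "degree P = degree P'"
    using assms nz unfolding is_min_poly_def by (meson le_antisym)
  have qx: "poly (map_poly of_rat q) x = 0"
    using assms unfolding q_def is_min_poly_def
    by (simp only: poly_of_rat_add poly_of_rat_smult)
  have "degree P \<le> degree q" using assms(1) q0 qx by (auto simp: is_min_poly_def)
  moreover have "degree q \<le> degree P"
    unfolding q_def using deg by (intro degree_add_le) auto
  moreover have "coeff q (degree P) = 0"
    using assms deg by (simp add: q_def is_min_poly_def)
  ultimately have "lead_coeff q = 0" by simp
  with q0 show False by simp
qed

text \<open>Minimality passes from \<open>x\<close> to every root \<open>z\<close> of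
  \<open>P\<close>. By induction the remainder \<open>P mod q\<close>, which vanishes at
  \<open>z\<close>, is 0, so \<open>P = q * s\<close>. One factor vanishes at \<open>x\<close> and
  thus has full degree; it cannot be \<open>q\<close>, so \<open>q\<close> is a nonzero constant,
  which has no root.\<close>

lemma conjugate_min_degree:
  fixes z :: "'a :: field_char_0"
  assumes P: "is_min_poly P x" and Pz: "poly (map_poly of_rat P) z = 0"
    and "poly (map_poly of_rat q) z = 0" and "degree q < degree P"
  shows "q = 0"
  using assms(3,4)
proof (induction "degree q" arbitrary: q rule: less_induct)
  case less
  show ?case
  proof (rule ccontr)
    assume "q \<noteq> 0"
    have Pnz: "P \<noteq> 0" using P by (auto simp: is_min_poly_def)
    have min: "degree P \<le> degree s" if "s \<noteq> 0" "poly (map_poly of_rat s) x = 0" for s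
      using P that by (auto simp: is_min_poly_def)
    have "P mod q = 0"
    proof (rule ccontr)
      assume nz: "P mod q \<noteq> 0"
      have "degree (P mod q) < degree q"
        using degree_mod_less[OF \<open>q \<noteq> 0\<close>, of P] nz by auto
      then show False
        using less.hyps[of "P mod q"] less.prems nz poly_of_rat_mod[OF Pz] by auto
    qed
    then obtain s where s: "P = q * s" by (auto simp: mod_eq_0_iff_dvd elim: dvdE)
    have "s \<noteq> 0" using s Pnz by auto
    have deg: "degree P = degree q + degree s"
      using s \<open>q \<noteq> 0\<close> \<open>s \<noteq> 0\<close> by (simp add: degree_mult_eq)
    have "poly (map_poly of_rat (q * s)) x = 0"
      using P s by (simp add: is_min_poly_def)
    then have "poly (map_poly of_rat q) x = 0 \<or> poly (map_poly of_rat s) x = 0"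
      by (simp add: poly_of_rat_mult)
    then have "degree q = 0"
      using min[OF \<open>q \<noteq> 0\<close>] min[OF \<open>s \<noteq> 0\<close>] less.prems(2) deg by auto
    then obtain c where "q = [:c:]" by (rule degree_eq_zeroE)
    then show False using less.prems(1) \<open>q \<noteq> 0\<close> by (simp add: poly_of_rat_pCons)
  qed
qed

lemma degree_6_eq:
  assumes "degree p \<le> 6"
  shows "p = [:coeff p 0, coeff p 1, coeff p 2, coeff p 3, coeff p 4, coeff p 5, coeff p 6:]"
  using assms
  by (intro poly_eqI)
    (auto simp: coeff_pCons numeral_eq_Suc coeff_eq_0 split: nat.split)

lemma cnj_of_rat: "cnj (of_rat c) = of_rat c"
  by (cases c) (simp add: of_rat_rat)

text \<open>A conjugate \<open>z\<close> on the unit circle is a root of \<open>P\<close> and, since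
  \<open>cnj z\<close> is its inverse, also of the polynomial with reversed coefficients. The latter
  must therefore be \<open>p0\<close> times \<open>P\<close>.\<close>

lemma salem_degree_6_self_reciprocal:
  assumes "salem \<beta>" and P: "is_min_poly P \<beta>"
    and eq: "P = [:p0, p1, p2, p3, p4, p5, 1:]"
  shows "p0 * p0 = 1 \<and> p5 = p0 * p1 \<and> p4 = p0 * p2 \<and> p3 = p0 * p3"
proof -
  from \<open>salem \<beta>\<close> obtain z where z: "z \<in> galois_conjugates \<beta>" "cmod z = 1"
    unfolding salem_def by blast
  have Pz: "poly (map_poly of_rat P) z = 0"
    using z(1) is_min_poly_unique[OF P] unfolding galois_conjugates_def by blast
  define w where "w = cnj z"
  have zw: "z * w = 1" using z(2) by (simp add: w_def complex_norm_square[symmetric])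
  have z0: "of_rat p0 + z * (of_rat p1 + z * (of_rat p2 + z * (of_rat p3 + z * (of_rat p4 +
    z * (of_rat p5 + z))))) = 0"
    using Pz unfolding eq by (simp add: poly_of_rat_pCons)
  from arg_cong[OF z0, of cnj]
  have w0: "of_rat p0 + w * (of_rat p1 + w * (of_rat p2 + w * (of_rat p3 + w * (of_rat p4 +
    w * (of_rat p5 + w))))) = 0"
    by (simp add: w_def cnj_of_rat)
  have r0: "1 + z * (of_rat p5 + z * (of_rat p4 + z * (of_rat p3 + z * (of_rat p2 +
    z * (of_rat p1 + z * of_rat p0))))) = 0"
  proof -
    \<comment> \<open>Multiplying by \<open>z\<close> cancels one factor \<open>w\<close>. Iterating
      this through \<open>horner\<close> moves the coefficients one by one from the Horner scheme in
      \<open>w\<close> to the reversed scheme in \<open>z\<close>.\<close>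
    have step: "z * t + s = 0" if "t + w * s = 0" for t s
    proof -
      have "z * t + s = z * t + (z * w) * s" using zw by simp
      also have "\<dots> = z * (t + w * s)" by (simp only: distrib_left mult.assoc)
      finally show ?thesis using that by simp
    qed
    have horner: "(c + z * t) + w * s = 0" if "t + w * (c + w * s) = 0" for c t s
      using step[OF that] by (simp add: add_ac)
    have "z * (of_rat p4 + z * (of_rat p3 + z * (of_rat p2 + z * (of_rat p1 + z * of_rat p0)))) +
        (of_rat p5 + w) = 0"
      by (rule step[OF horner[OF horner[OF horner[OF horner[OF w0]]]]])
    then have "(of_rat p5 + z * (of_rat p4 + z * (of_rat p3 + z * (of_rat p2 +
        z * (of_rat p1 + z * of_rat p0))))) + w * 1 = 0"
      by (simp add: add_ac)
    from step[OF this] show ?thesis by (simp add: add_ac)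
  qed
  \<comment> \<open>This is the reversed polynomial minus \<open>p0\<close> times \<open>P\<close>.
    The terms of degree 6 cancel, so its degree is too small for a nonzero polynomial with root
    \<open>z\<close>.\<close>
  define q where "q = [:1 - p0 * p0, p5 - p0 * p1, p4 - p0 * p2, p3 - p0 * p3,
    p2 - p0 * p4, p1 - p0 * p5:]"
  have "poly (map_poly of_rat q) z =
    (1 + z * (of_rat p5 + z * (of_rat p4 + z * (of_rat p3 + z * (of_rat p2 +
      z * (of_rat p1 + z * of_rat p0)))))) -
    of_rat p0 * (of_rat p0 + z * (of_rat p1 + z * (of_rat p2 + z * (of_rat p3 + z * (of_rat p4 +
      z * (of_rat p5 + z))))))"
    by (simp add: q_def poly_of_rat_pCons of_rat_diff of_rat_mult algebra_simps)
  then have "poly (map_poly of_rat q) z = 0" using z0 r0 by simp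
  moreover have "degree q \<le> 5"
    unfolding q_def by (rule order.trans[OF degree_pCons_le], simp)+
  then have "degree q < degree P" by (simp add: eq)
  ultimately have "q = 0" using conjugate_min_degree[OF P Pz] by blast
  then show ?thesis unfolding q_def pCons_eq_0_iff right_minus_eq by metis
qed

section \<open>Greedy expansions\<close>

lemma beta_rem_bounds: "0 \<le> beta_rem \<beta> n \<and> beta_rem \<beta> n \<le> 1"
  by (cases n) (auto intro: less_imp_le[OF frac_lt_1] simp flip: frac_def)

lemma beta_rem_Suc_digit: "beta_rem \<beta> (Suc n) = \<beta> * beta_rem \<beta> n - of_int (beta_digit \<beta> (Suc n))"
  by (simp add: beta_digit_def)

lemma beta_digit_nonneg:
  assumes "\<beta> > 1"
  shows "0 \<le> beta_digit \<beta> n"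
  using assms beta_rem_bounds[of \<beta> "n - 1"] by (simp add: beta_digit_def)

lemma beta_digit_le_first:
  assumes "\<beta> > 1"
  shows "beta_digit \<beta> n \<le> beta_digit \<beta> 1"
  using assms beta_rem_bounds[of \<beta> "n - 1"] unfolding beta_digit_def
  by (intro floor_mono mult_left_mono) auto

text \<open>Subtracting the same digit from \<beta> times \<open>beta_rem \<beta> n\<close> and from
  \<beta> times the initial remainder 1 keeps their order. This is the second step of the
  lexicographic condition on greedy expansions.\<close>

lemma beta_digit_le_second:
  assumes "\<beta> > 1" and "beta_digit \<beta> (Suc n) = beta_digit \<beta> 1"
  shows "beta_digit \<beta> (Suc (Suc n)) \<le> beta_digit \<beta> 2"
proof -
  have "\<beta> * beta_rem \<beta> n \<le> \<beta> * beta_rem \<beta> 0"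
    using assms(1) beta_rem_bounds[of \<beta> n] by (intro mult_left_mono) auto
  then have "beta_rem \<beta> (Suc n) \<le> beta_rem \<beta> (Suc 0)"
    using assms(2) by (simp only: beta_rem_Suc_digit) simp
  then have "\<beta> * beta_rem \<beta> (Suc n) \<le> \<beta> * beta_rem \<beta> (Suc 0)"
    using assms(1) by (intro mult_left_mono) auto
  then show ?thesis
    unfolding beta_digit_def by (intro floor_mono) (simp add: numeral_2_eq_2)
qed

section \<open>Coefficients of the companion polynomial\<close>

lemma monom_numeral_eq_pCons:
  "monom c 1 = [:0, c:]" "monom c (Suc 0) = [:0, c:]" "monom c 2 = [:0, 0, c:]"
  "monom c 3 = [:0, 0, 0, c:]" "monom c 4 = [:0, 0, 0, 0, c:]" "monom c 5 = [:0, 0, 0, 0, 0, c:]"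
  "monom c 6 = [:0, 0, 0, 0, 0, 0, c:]" "monom c 7 = [:0, 0, 0, 0, 0, 0, 0, c:]"
  "monom c 8 = [:0, 0, 0, 0, 0, 0, 0, 0, c:]"
  by (simp_all add: numeral_eq_Suc monom_Suc monom_0)

text \<open>Here R is P_8 - P_1, and subtracting P_1 = x - c_1 produces the extra \<open>c 1\<close>
  in the constant term and the extra \<open>- 1\<close> in the linear one.\<close>

lemma companion_poly_1_7:
  assumes "preperiod_length \<beta> = 1" and "period_length \<beta> = 7"
  shows "companion_poly \<beta> =
    (let c = beta_digit \<beta> in [:c 1 - c 8, - c 7 - 1, - c 6, - c 5, - c 4, - c 3, - c 2, - c 1, 1:])"
proof -
  define c where "c = beta_digit \<beta>"
  have "{1..8::nat} = {1, 2, 3, 4, 5, 6, 7, 8}" by auto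
  then have "(\<Sum>i=1..8. monom (c i) (8 - i)) = [:c 8, c 7, c 6, c 5, c 4, c 3, c 2, c 1:]"
    by (simp add: monom_numeral_eq_pCons monom_0)
  then show ?thesis
    unfolding companion_poly_def beta_poly_def assms Let_def c_def[symmetric]
    by (simp add: monom_numeral_eq_pCons monom_0)
qed

section \<open>Sequences with two periods\<close>

lemma periodic_mult:
  assumes "\<And>n :: nat. f (n + p) = f n"
  shows "f (n + p * k) = f n"
proof (induction k)
  case (Suc k)
  then show ?case using assms[of "n + p * k"] by (simp add: algebra_simps)
qed simp

text \<open>By Bezout some multiple of \<open>p\<close> exceeds a multiple of \<open>q\<close> by 1,
  so a shift by 1 leaves \<open>f\<close> unchanged.\<close>

lemma periodic_coprime_constant:
  assumes p: "\<And>n :: nat. f (n + p) = f n" and q: "\<And>n :: nat. f (n + q) = f n"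
    and "coprime p q" and "p > 0"
  shows "f n = f 0"
proof (induction n)
  case (Suc n)
  obtain x y where xy: "p * x = q * y + 1"
    using bezout_nat[of p q] assms(3,4) by (auto simp: coprime_iff_gcd_eq_1)
  have "f n = f (Suc n + q * y)"
    using periodic_mult[of f p n x, OF p] xy by simp
  also have "\<dots> = f (Suc n)" by (rule periodic_mult[of f q, OF q])
  finally show ?case using Suc by simp
qed simp

section \<open>Expansions certified by prescribed digits\<close>

text \<open>The value at \<open>x\<close> of x^n - d_1 x^(n-1) - ... - d_n. For the true digits and
  x = \<beta> this is the remainder r_n, but no floor is taken, so it can be evaluated and compared
  at rational points.\<close>

primrec horner :: "(nat \<Rightarrow> int) \<Rightarrow> real \<Rightarrow> nat \<Rightarrow> real" where
  "horner d x 0 = 1"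
| "horner d x (Suc n) = x * horner d x n - of_int (d (Suc n))"

text \<open>Each step multiplies by the argument and subtracts the same digit, which preserves the
  order as long as the earlier values at \<open>x\<close> are nonnegative.\<close>

lemma horner_mono:
  assumes "0 \<le> x" and "x \<le> y" and "\<And>k. k < n \<Longrightarrow> 0 \<le> horner d x k"
  shows "horner d x n \<le> horner d y n"
  using assms(3)
proof (induction n)
  case (Suc n)
  then have "horner d x n \<le> horner d y n" "0 \<le> horner d x n" by auto
  then show ?case using assms(1,2) by (auto intro: mult_mono)
qed simp

text \<open>A certificate that \<open>d\<close> lists the first eight digits. The bounds identify
  the floors, \<open>r_8\<close> makes the remainders repeat, \<open>d_8\<close> excludes preperiod
  0, and \<open>d_nonconst\<close> excludes periods below 7.\<close>

locale expansion_1_7 =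
  fixes \<beta> :: real and d :: "nat \<Rightarrow> int"
  assumes r_bounds: "\<And>n. 1 \<le> n \<Longrightarrow> n \<le> 7 \<Longrightarrow> 0 < horner d \<beta> n \<and> horner d \<beta> n < 1"
    and r_8: "horner d \<beta> 8 = horner d \<beta> 1"
    and d_8: "d 8 \<noteq> d 1"
    and d_nonconst: "\<exists>i \<in> {2..8}. d i \<noteq> d 2"
begin

abbreviation r :: "nat \<Rightarrow> real" where "r \<equiv> horner d \<beta>"

lemma r_bounds_8:
  assumes "1 \<le> n" and "n \<le> 8"
  shows "0 < r n \<and> r n < 1"
  using r_bounds[of n] r_bounds[of 1] assms r_8 by (cases "n = 8") auto

text \<open>An integer \<open>d (Suc n)\<close> that leaves a remainder in (0,1) is necessarily the
  floor chosen by the greedy algorithm.\<close>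

lemma beta_rem_eq:
  assumes "n \<le> 8"
  shows "beta_rem \<beta> n = r n"
  using assms
proof (induction n)
  case (Suc n)
  then have "\<lfloor>\<beta> * r n\<rfloor> = d (Suc n)"
    using r_bounds_8[of "Suc n"] by (intro floor_unique) auto
  then show ?case using Suc by simp
qed simp

lemma beta_digit_eq:
  assumes "1 \<le> n" and "n \<le> 8"
  shows "beta_digit \<beta> n = d n"
proof -
  from assms(1) obtain k where k: "n = Suc k" by (cases n) auto
  have "of_int (beta_digit \<beta> n) = \<beta> * beta_rem \<beta> k - beta_rem \<beta> n"
    using beta_rem_Suc_digit[of \<beta> k] k by simp
  also have "\<dots> = of_int (d n)"
    using beta_rem_eq[of k] beta_rem_eq[of n] assms(2) k by simp
  finally show ?thesis by simp
qed

lemma beta_rem_periodic: "beta_rem \<beta> (n + 8) = beta_rem \<beta> (n + 1)"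
proof (induction n)
  case 0
  then show ?case using beta_rem_eq[of 8] beta_rem_eq[of 1] r_8 by simp
next
  case (Suc n)
  then show ?case by (simp only: add_Suc beta_rem.simps)
qed

lemma beta_digit_periodic:
  assumes "n \<ge> 2"
  shows "beta_digit \<beta> (n + 7) = beta_digit \<beta> n"
proof -
  obtain k where "n = k + 2" using assms by (metis add.commute le_Suc_ex)
  then show ?thesis using beta_rem_periodic[of k] by (simp add: beta_digit_def eval_nat_numeral)
qed

lemma beta_periodic_1_7: "beta_periodic \<beta> 1 7"
  unfolding beta_periodic_def using beta_digit_periodic[of "Suc _"] by (simp add: add_ac)

text \<open>Rules out a finite expansion, for which \<open>period_length\<close> would be 0 by
  convention.\<close>

lemma beta_rem_pos: "0 < beta_rem \<beta> n"
proof (induction n rule: less_induct)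
  case (less n)
  show ?case
  proof (cases "n \<le> 8")
    case True
    then show ?thesis
      using beta_rem_eq[OF True] r_bounds_8[of n] by (cases "n = 0") auto
  next
    case False
    then have "beta_rem \<beta> n = beta_rem \<beta> (n - 7)"
      using beta_rem_periodic[of "n - 8"] by (simp add: eval_nat_numeral Suc_diff_Suc)
    then show ?thesis using less[of "n - 7"] False by simp
  qed
qed

text \<open>Pure periodicity with period \<open>p\<close> equates digit 1 with digit 1 + 7p. The
  latter is 8 + 7(p - 1), so the known period 7 equates it with digit 8, against
  \<open>d_8\<close>.\<close>

lemma not_beta_periodic_0: "\<not> beta_periodic \<beta> 0 p"
proof
  assume "beta_periodic \<beta> 0 p"
  then have p: "p \<ge> 1"
    and per: "\<forall>n\<ge>1. beta_digit \<beta> (n + 0) = beta_digit \<beta> (n + 0 + p)"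
    unfolding beta_periodic_def by blast+
  obtain k where k: "p = Suc k" using p by (cases p) auto
  define f where "f n = beta_digit \<beta> (Suc n)" for n
  define g where "g n = beta_digit \<beta> (n + 2)" for n
  have "f (n + p) = f n" for n using per[rule_format, of "Suc n"] by (simp add: f_def)
  then have "f (0 + p * 7) = f 0" by (rule periodic_mult)
  moreover have "g (n + 7) = g n" for n
    using beta_digit_periodic[of "n + 2"] by (simp add: g_def add_ac)
  then have "g (6 + 7 * k) = g 6" by (rule periodic_mult)
  moreover have "f (0 + p * 7) = g (6 + 7 * k)" by (simp add: f_def g_def k mult.commute)
  ultimately have "beta_digit \<beta> 8 = beta_digit \<beta> 1" by (simp add: f_def g_def)
  then show False using beta_digit_eq[of 8] beta_digit_eq[of 1] d_8 by simp
qed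

lemma preperiod_length_eq: "preperiod_length \<beta> = 1"
  unfolding preperiod_length_def
proof (rule Least_equality)
  show "\<exists>p. beta_periodic \<beta> 1 p" using beta_periodic_1_7 by blast
  show "1 \<le> m" if "\<exists>p. beta_periodic \<beta> m p" for m
    using that not_beta_periodic_0 by (cases m) auto
qed

text \<open>A period below the prime 7 would be coprime to it, which would make all digits from
  index 2 on equal.\<close>

lemma period_ge_7:
  assumes "beta_periodic \<beta> 1 p"
  shows "7 \<le> p"
proof (rule ccontr)
  assume "\<not> 7 \<le> p"
  define f where "f n = beta_digit \<beta> (n + 2)" for n
  have "p > 0" using assms by (simp add: beta_periodic_def)
  have "prime (7 :: nat)" by simp
  have "coprime p 7"
    using prime_imp_coprime[OF \<open>prime (7 :: nat)\<close>, of p] \<open>p > 0\<close> \<open>\<not> 7 \<le> p\<close>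
    by (auto simp: coprime_commute dest: dvd_imp_le)
  have "f (n + p) = f n" for n
  proof -
    have "beta_digit \<beta> (Suc n + 1) = beta_digit \<beta> (Suc n + 1 + p)"
      using assms unfolding beta_periodic_def by (elim conjE allE[of _ "Suc n"]) simp
    then show ?thesis by (simp add: f_def)
  qed
  moreover have "f (n + 7) = f n" for n
    using beta_digit_periodic[of "n + 2"] by (simp add: f_def add_ac)
  ultimately have const: "f n = f 0" for n
    using \<open>coprime p 7\<close> \<open>p > 0\<close> by (rule periodic_coprime_constant)
  obtain i where i: "i \<in> {2..8}" "d i \<noteq> d 2" using d_nonconst by blast
  have "d i = f (i - 2)" using i(1) beta_digit_eq[of i] by (simp add: f_def del: add_2_eq_Suc')
  moreover have "d 2 = f 0" using beta_digit_eq[of 2] by (simp add: f_def del: add_2_eq_Suc')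
  ultimately show False using const i(2) by metis
qed

lemma period_length_eq: "period_length \<beta> = 7"
proof -
  have "(LEAST p. beta_periodic \<beta> 1 p) = 7"
    using beta_periodic_1_7 period_ge_7 by (rule Least_equality)
  moreover have "\<not> (\<exists>N. beta_rem \<beta> N = 0)"
    using beta_rem_pos by (metis less_irrefl)
  ultimately show ?thesis unfolding period_length_def preperiod_length_eq by simp
qed

end

section \<open>The three polynomials\<close>

text \<open>Division by t^3 turns the reciprocal sextic into h^3 - (3 + k) h with h = t + 1/t. On t
  \<ge> 1, h increases and is at least 2, so the difference quotient in h is at least 12 - (3 + k) >
  0. The inequality is cross-multiplied to avoid fractions.\<close>

lemma sextic_quotient_strict_mono:
  fixes x y k :: real
  assumes "1 \<le> x" and "x < y" and "k \<le> 2"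
  shows "(x ^ 6 - k * x ^ 4 - k * x ^ 2 + 1) * y ^ 3 < (y ^ 6 - k * y ^ 4 - k * y ^ 2 + 1) * x ^ 3"
proof -
  define h where "h t = t + 1 / t" for t :: real
  have id: "t ^ 6 - k * t ^ 4 - k * t ^ 2 + 1 = t ^ 3 * (h t ^ 3 - (3 + k) * h t)" if "t \<ge> 1" for t
  proof -
    have "t * (1 / t) = 1" using that by simp
    then show ?thesis unfolding h_def by algebra
  qed
  have h2: "h t \<ge> 2" if "t \<ge> 1" for t
  proof -
    have "0 \<le> (t - 1)\<^sup>2" by simp
    then show ?thesis using that by (simp add: h_def field_simps power2_eq_square)
  qed
  have "h y - h x = (y - x) * (x * y - 1) / (x * y)"
    using assms by (simp add: h_def field_simps)
  moreover have "x * y > 1"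
  proof -
    have "1 * y \<le> x * y" using assms by (intro mult_right_mono) auto
    then show ?thesis using assms by linarith
  qed
  then have "0 < (y - x) * (x * y - 1) / (x * y)"
    using assms by (intro divide_pos_pos mult_pos_pos) auto
  ultimately have lt: "h x < h y" by simp
  have "h x * h x \<ge> 2 * 2" "h x * h y \<ge> 2 * 2" "h y * h y \<ge> 2 * 2"
    using h2[of x] h2[of y] assms by (intro mult_mono; simp)+
  then have "h y * h y + h x * h y + h x * h x - (3 + k) > 0" using assms(3) by simp
  then have "0 < (h y - h x) * (h y * h y + h x * h y + h x * h x - (3 + k))"
    using lt by simp
  also have "\<dots> = (h y ^ 3 - (3 + k) * h y) - (h x ^ 3 - (3 + k) * h x)"
    by (simp add: algebra_simps power3_eq_cube)
  finally have "(x ^ 3 * y ^ 3) * (h x ^ 3 - (3 + k) * h x) <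
      (x ^ 3 * y ^ 3) * (h y ^ 3 - (3 + k) * h y)"
    using assms by (intro mult_strict_left_mono) auto
  then show ?thesis
    using assms id[of x] id[of y] by (simp add: mult_ac)
qed

text \<open>After division by x^3 the middle coefficient \<open>b\<close> is the level that a
  strictly increasing function attains at the root, so the signs at \<open>l\<close> and
  \<open>u\<close> place the root between them.\<close>

lemma sextic_root_bounds:
  fixes x k b l u :: real
  assumes "1 \<le> x" and root: "x ^ 6 - k * x ^ 4 - b * x ^ 3 - k * x ^ 2 + 1 = 0" and "k \<le> 2"
    and "1 \<le> l" and l: "l ^ 6 - k * l ^ 4 - b * l ^ 3 - k * l ^ 2 + 1 < 0"
    and "1 \<le> u" and u: "u ^ 6 - k * u ^ 4 - b * u ^ 3 - k * u ^ 2 + 1 > 0"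
  shows "l < x \<and> x < u"
proof -
  have x3: "x ^ 6 - k * x ^ 4 - k * x ^ 2 + 1 = b * x ^ 3" using root by simp
  have l3: "(l ^ 6 - k * l ^ 4 - k * l ^ 2 + 1) * x ^ 3 < b * l ^ 3 * x ^ 3"
    using l assms by (intro mult_strict_right_mono) auto
  have u3: "b * u ^ 3 * x ^ 3 < (u ^ 6 - k * u ^ 4 - k * u ^ 2 + 1) * x ^ 3"
    using u assms by (intro mult_strict_right_mono) auto
  have "\<not> x < l"
    using sextic_quotient_strict_mono[of x l k] assms(1,3) x3 l3 by (auto simp: mult_ac)
  moreover have "\<not> u < x"
    using sextic_quotient_strict_mono[of u x k] assms(3,6) x3 u3 by (auto simp: mult_ac)
  moreover have "x \<noteq> l" "x \<noteq> u" using root l u by auto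
  ultimately show ?thesis by auto
qed

text \<open>By \<open>horner_mono\<close>, positivity of the candidate remainders need only be
  checked at \<open>l\<close>, and the bound 1 only at \<open>u\<close>.\<close>

lemma salem_parry_1_7I:
  assumes "salem \<beta>" and P: "is_min_poly P \<beta>"
    and R: "P * [:1, -1, 1:] = map_poly of_int
      [:d 1 - d 8, - d 7 - 1, - d 6, - d 5, - d 4, - d 3, - d 2, - d 1, 1:]"
    and "0 < l" and "l < \<beta>" and "\<beta> < u"
    and lo: "\<forall>n \<in> {1..7}. 0 < horner d l n" and hi: "\<forall>n \<in> {1..7}. horner d u n < 1"
    and d: "d 8 \<noteq> d 1" "\<exists>i \<in> {2..8}. d i \<noteq> d 2"
  shows "\<beta> \<in> salem_parry_numbers 1 7 \<inter> salem_with_cofactor [:1, -1, 1:]"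
proof -
  have lo': "0 < horner d l n" if "n \<le> 7" for n
    using lo that by (cases "n = 0") auto
  have below: "horner d l n \<le> horner d \<beta> n" if "n \<le> 7" for n
    using assms(4,5) lo' that by (intro horner_mono) (auto intro: less_imp_le)
  have above: "horner d \<beta> n \<le> horner d u n" if "n \<le> 7" for n
    using assms(4-6) lo' below that
    by (intro horner_mono) (auto intro: order.trans[OF less_imp_le])
  \<comment> \<open>By \<open>R\<close> this product is the candidate P_8 - P_1, so its vanishing at
    \<beta> says that the remainders of index 8 and 1 agree.\<close>
  have "poly (map_poly of_rat (P * [:1, -1, 1:])) \<beta> = 0"
    using P by (simp only: poly_of_rat_mult) (simp add: is_min_poly_def)
  then have "horner d \<beta> 8 = horner d \<beta> 1"
    unfolding R
    by (simp add: map_poly_pCons of_rat_minus of_rat_diff eval_nat_numeral algebra_simps)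
  moreover have "0 < horner d \<beta> n \<and> horner d \<beta> n < 1" if "1 \<le> n" "n \<le> 7" for n
    using less_le_trans[OF lo'[of n] below[of n]] le_less_trans[OF above[of n], of 1] hi that
    by simp
  ultimately interpret expansion_1_7 \<beta> d
    using d by unfold_locales
  note lengths = preperiod_length_eq period_length_eq
  have "companion_poly \<beta> = [:d 1 - d 8, - d 7 - 1, - d 6, - d 5, - d 4, - d 3, - d 2, - d 1, 1:]"
    using companion_poly_1_7[OF lengths] by (simp add: Let_def beta_digit_eq del: One_nat_def)
  moreover have "map_poly of_int [:1, -1, 1:] = [:1, -1, 1 :: rat:]" by (simp add: map_poly_pCons)
  ultimately have "is_cofactor [:1, -1, 1:] \<beta>"
    using P R unfolding is_cofactor_def by metis
  moreover have "parry \<beta>"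
    using \<open>salem \<beta>\<close> beta_periodic_1_7 unfolding parry_def salem_def by blast
  ultimately show ?thesis
    using \<open>salem \<beta>\<close> lengths by (simp add: salem_parry_numbers_def salem_with_cofactor_def)
qed

text \<open>Replaces the enclosure of \<beta> by sign conditions at \<open>l\<close> and
  \<open>u\<close>, so that for concrete data every remaining condition is a numerical
  computation.\<close>

lemma salem_sextic_1_7I:
  fixes k b :: int
  assumes "salem \<beta>" and P: "is_min_poly P \<beta>"
    and eq: "P = [:1, 0, - of_int k, - of_int b, - of_int k, 0, 1:]"
    and "k \<le> 2" and "1 \<le> l" and "1 \<le> u"
    and "l ^ 6 - of_int k * l ^ 4 - of_int b * l ^ 3 - of_int k * l ^ 2 + 1 < 0"
    and "u ^ 6 - of_int k * u ^ 4 - of_int b * u ^ 3 - of_int k * u ^ 2 + 1 > 0"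
    and "P * [:1, -1, 1:] = map_poly of_int
      [:d 1 - d 8, - d 7 - 1, - d 6, - d 5, - d 4, - d 3, - d 2, - d 1, 1:]"
    and "\<forall>n \<in> {1..7}. 0 < horner d l n" and "\<forall>n \<in> {1..7}. horner d u n < 1"
    and "d 8 \<noteq> d 1" and "\<exists>i \<in> {2..8}. d i \<noteq> d 2"
  shows "\<beta> \<in> salem_parry_numbers 1 7 \<inter> salem_with_cofactor [:1, -1, 1:]"
proof -
  have "poly (map_poly of_rat P) \<beta> = 0" using P by (simp add: is_min_poly_def)
  then have "\<beta> ^ 6 - of_int k * \<beta> ^ 4 - of_int b * \<beta> ^ 3 - of_int k * \<beta> ^ 2 + 1 = 0"
    unfolding eq by (simp add: map_poly_pCons of_rat_minus power_numeral_reduce algebra_simps)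
  then have "l < \<beta> \<and> \<beta> < u"
    using assms by (intro sextic_root_bounds) (auto simp: salem_def)
  then show ?thesis
    using assms by (intro salem_parry_1_7I[where d = d and l = l and u = u, OF assms(1,2)]) auto
qed

lemma salem_parry_1_7D:
  assumes "\<beta> \<in> salem_parry_numbers 1 7 \<inter> salem_with_cofactor [:1, -1, 1:]"
    and P: "is_min_poly P \<beta>" and eq: "P = [:p0, p1, p2, p3, p4, p5, 1:]"
  shows "P = [:1, 0, -1, -1, -1, 0, 1:] \<or> P = [:1, 0, -1, -2, -1, 0, 1:] \<or>
    P = [:1, 0, -2, -3, -2, 0, 1:]"
proof -
  define c where "c = beta_digit \<beta>"
  have salem: "salem \<beta>" and lengths: "preperiod_length \<beta> = 1" "period_length \<beta> = 7"
    and cof: "is_cofactor [:1, -1, 1:] \<beta>"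
    using assms(1) by (auto simp: salem_parry_numbers_def salem_with_cofactor_def)
  have "\<beta> > 1" using salem by (simp add: salem_def)
  have "map_poly of_int (companion_poly \<beta>) = P * map_poly of_int [:1, -1, 1:]"
    using cof is_min_poly_unique[OF P] unfolding is_cofactor_def by blast
  then have "p0 = of_int (c 1 - c 8)" "p1 - p0 = of_int (- c 7 - 1)"
    "p2 - p1 + p0 = of_int (- c 6)" "p3 - p2 + p1 = of_int (- c 5)"
    "p4 - p3 + p2 = of_int (- c 4)" "p5 - p4 + p3 = of_int (- c 3)"
    "1 - p5 + p4 = of_int (- c 2)" "p5 - 1 = of_int (- c 1)"
    unfolding companion_poly_1_7[OF lengths] eq c_def
    by (simp_all add: Let_def map_poly_pCons)
  note R = this
  have rec: "p0 * p0 = 1" "p5 = p0 * p1" "p4 = p0 * p2"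
    using salem_degree_6_self_reciprocal[OF salem P eq] by auto
  have le1: "c n \<le> c 1" for n using beta_digit_le_first[OF \<open>\<beta> > 1\<close>] by (simp add: c_def)
  have nonneg: "0 \<le> c n" for n using beta_digit_nonneg[OF \<open>\<beta> > 1\<close>] by (simp add: c_def)
  have le2: "c (Suc n) = c 1 \<Longrightarrow> c (Suc (Suc n)) \<le> c 2" for n
    using beta_digit_le_second[OF \<open>\<beta> > 1\<close>] by (simp add: c_def)
  \<comment> \<open>The constant term is \<open>c 1 - c 8\<close>, and no digit exceeds the first;
    this excludes the sign -1 left open by reciprocity.\<close>
  have "p0 \<ge> 0" using R(1) le1[of 8] by simp
  with rec(1) have p0: "p0 = 1" by (auto simp: square_eq_1_iff)
  note lin = R[unfolded p0 of_int_minus of_int_diff of_int_1] rec(2,3)[unfolded p0 mult_1]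
  have p: "p1 = - of_int (c 7)" "p5 = - of_int (c 7)" "p2 = - of_int (c 7) - 1 - of_int (c 6)"
    "p4 = - of_int (c 7) - 1 - of_int (c 6)" "p3 = - 1 - of_int (c 6) - of_int (c 5)"
    using lin by linarith+
  have "of_int (c 1) = (of_int (c 7 + 1) :: rat)" "of_int (c 2) = (of_int (c 6) :: rat)"
    "of_int (c 3) = (of_int (c 5) :: rat)" "of_int (c 4) = (of_int (2 * c 7 + 1 + c 6 - c 5) :: rat)"
    unfolding of_int_add of_int_diff of_int_mult of_int_1 of_int_numeral using lin p by linarith+
  then have c: "c 1 = c 7 + 1" "c 2 = c 6" "c 3 = c 5" "c 4 = 2 * c 7 + 1 + c 6 - c 5"
    by (simp_all only: of_int_eq_iff)
  \<comment> \<open>The bounds \<open>c 4 \<le> c 1\<close> and \<open>c 3 \<le> c 1\<close> say c_7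
    + c_6 \<le> c_5 \<le> c_7 + 1, so c_6 is 0 or 1. If c_5 = c_7 + 1, then c_3 = c_1 and the first
    rule forces c_7 = 0; otherwise c_6 = 0 and c_5 = c_7, so c_4 = c_1 and the second rule
    does.\<close>
  have "c 3 = c 1 \<Longrightarrow> c 4 \<le> c 2" "c 4 = c 1 \<Longrightarrow> c 5 \<le> c 2"
    using le2[of 2] le2[of 3] by (simp_all add: eval_nat_numeral)
  then have "c 7 = 0 \<and> (c 6 = 0 \<and> c 5 = 0 \<or> c 6 = 0 \<and> c 5 = 1 \<or> c 6 = 1 \<and> c 5 = 1)"
    using le1[of 3] le1[of 4] nonneg[of 7] nonneg[of 6] unfolding c by linarith
  then show ?thesis unfolding eq p p0 by auto
qed

theorem proposition2p4:
  fixes \<beta> :: real and P :: "rat poly"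
  assumes "salem \<beta>"
    and "is_min_poly P \<beta>"
    and "degree P = 6"
  shows "\<beta> \<in> salem_parry_numbers 1 7 \<inter> salem_with_cofactor [:1, -1, 1:] \<longleftrightarrow>
           P = monom 1 6 - monom 1 4 - monom 1 3 - monom 1 2 + 1 \<or>
           P = monom 1 6 - monom 1 4 - monom 2 3 - monom 1 2 + 1 \<or>
           P = monom 1 6 - monom 2 4 - monom 3 3 - monom 2 2 + 1"
proof -
  have "coeff P 6 = 1" using assms(2,3) by (simp add: is_min_poly_def)
  then obtain p0 p1 p2 p3 p4 p5 where eq: "P = [:p0, p1, p2, p3, p4, p5, 1:]"
    using degree_6_eq[of P] assms(3) by auto
  have lists:
    "monom 1 6 - monom 1 4 - monom 1 3 - monom 1 2 + 1 = [:1, 0, -1, -1, -1, 0, 1 :: rat:]"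
    "monom 1 6 - monom 1 4 - monom 2 3 - monom 1 2 + 1 = [:1, 0, -1, -2, -1, 0, 1 :: rat:]"
    "monom 1 6 - monom 2 4 - monom 3 3 - monom 2 2 + 1 = [:1, 0, -2, -3, -2, 0, 1 :: rat:]"
    by (simp_all add: monom_numeral_eq_pCons one_pCons)
  have range: "{1..7} = {1, 2, 3, 4, 5, 6, 7 :: nat}" by auto
  have "\<beta> \<in> salem_parry_numbers 1 7 \<inter> salem_with_cofactor [:1, -1, 1:]"
    if P: "P = [:1, 0, -1, -1, -1, 0, 1:]"
    \<comment> \<open>The list holds the digits c_1, ..., c_8, read off from the coefficients of
      P(x)(x^2 - x + 1); \<open>n - 1\<close> shifts to list positions counted from 0. The endpoints
      enclose the root \<beta>, and the witness for \<open>bexI\<close> is an index whose digit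
      differs from the second.\<close>
    by (rule salem_sextic_1_7I[OF assms(1,2), where k = 1 and b = 1 and
          d = "\<lambda>n. [1, 0, 0, 1, 0, 0, 0, 0] ! (n - 1)" and
          l = "7 / 5" and u = "141 / 100"];
        (rule bexI[of _ 4])?; (unfold range)?;
        (simp add: P map_poly_pCons power_divide eval_nat_numeral)?)
  moreover have "\<beta> \<in> salem_parry_numbers 1 7 \<inter> salem_with_cofactor [:1, -1, 1:]"
    if P: "P = [:1, 0, -1, -2, -1, 0, 1:]"
    by (rule salem_sextic_1_7I[OF assms(1,2), where k = 1 and b = 2 and
          d = "\<lambda>n. [1, 0, 1, 0, 1, 0, 0, 0] ! (n - 1)" and
          l = "79 / 50" and u = "159 / 100"];
        (rule bexI[of _ 3])?; (unfold range)?;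
        (simp add: P map_poly_pCons power_divide eval_nat_numeral)?)
  moreover have "\<beta> \<in> salem_parry_numbers 1 7 \<inter> salem_with_cofactor [:1, -1, 1:]"
    if P: "P = [:1, 0, -2, -3, -2, 0, 1:]"
    \<comment> \<open>Here \<beta> is close to 2, and each Horner step enlarges the deviation of an
      endpoint from \<beta> by a factor of about 2 or more; the short interval keeps all seven
      values within (0,1).\<close>
    by (rule salem_sextic_1_7I[OF assms(1,2), where k = 2 and b = 3 and
          d = "\<lambda>n. [1, 1, 1, 1, 1, 1, 0, 0] ! (n - 1)" and
          l = "19877 / 10000" and u = "9939 / 5000"];
        (rule bexI[of _ 8])?; (unfold range)?;
        (simp add: P map_poly_pCons power_divide eval_nat_numeral)?)
  moreover have "P = [:1, 0, -1, -1, -1, 0, 1:] \<or> P = [:1, 0, -1, -2, -1, 0, 1:] \<or>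
      P = [:1, 0, -2, -3, -2, 0, 1:]"
    if "\<beta> \<in> salem_parry_numbers 1 7 \<inter> salem_with_cofactor [:1, -1, 1:]"
    using salem_parry_1_7D[OF that assms(2) eq] .
  ultimately show ?thesis unfolding lists by blast
qed

end
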